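(* Let $(X^*,y^*,S^* )$ satisfy the optimality conditions $$\mathcal{A}(X^* )=b,\quad X^*\succeq 0,\quad \mathcal{A}^*(y^* )+S^*=C,\quad S^*\succeq 0,\quad X^*S^*=0 .$$ Let the sequence of iterates be generated by the inexact ADMM (QADMM) scheme described in the context, started at $(X^0,y^0,S^0)$, and for $K\ge 1$ let $$(\bar X^K,\bar y^K,\bar S^K):=\frac1K\sum_{k=1}^{K}(\tilde X^k,\hat y^k,\tilde S^k).$$ Then, with $f(y)=-b^\top y$, $$f(\bar y^K)-f(y^* )\le \mathcal{O}\!\left(\frac{\|X^0-X^*\|_{\mathrm F}^2+\|S^0-S^*\|_{\mathrm F}^2}{K}+\delta\right),$$ $$\left\|\mathcal{A}^*(\bar y^K)+\bar S^K-C\right\|_{\mathrm F}\le \mathcal{O}\!\left(\frac{\|X^0-X^*\|_{\mathrm F}+\|S^0-S^*\|_{\mathrm F}}{K}+\delta\right),$$ where $\delta=\Theta(\delta_{\tilde y}+\delta_y+\delta_V+\delta_X+\delta_S+\delta_{\tilde S}+\delta_{\tilde X})$ is the accumulated inexactness. (When the $y$-linear system is solved by a quantum linear solver with accuracy parameter $\delta_{\hat y}$, this parameter is chosen so that $\delta_{\tilde y}=\Theta(\delta_{\hat y})$.)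
   Context: **Problem.** $\mathbb{S}^n$ is the space of real symmetric $n\times n$ matrices with $\langle A,B\rangle=\mathrm{Tr}(A^\top B)$; $\mathbb{S}^n_+$ is the cone of positive semidefinite matrices. Given $A^{(1)},\dots,A^{(m)},C\in\mathbb{S}^n$ with $\|A^{(i)}\|_{\mathrm F}\le1$, $\|C\|_{\mathrm F}\le 1$, and $b\in\mathbb{R}^m$, put $\mathcal{A}(X)=(\langle A^{(1)},X\rangle,\dots,\langle A^{(m)},X\rangle)^\top$ and $\mathcal{A}^*(y)=\sum_i y_iA^{(i)}$. The operator $\mathcal{A}\mathcal{A}^*\in\mathbb{R}^{m\times m}$ (entries $\langle A^{(i)},A^{(j)}\rangle$) is assumed positive definite. The primal SDP is $\min\{\langle C,X\rangle:\mathcal{A}(X)=b,\ X\succeq0\}$ and the dual SDP is $\min\{-b^\top y:\mathcal{A}^*(y)+S=C,\ S\succeq0\}$. Standing assumption: there are known $R_X,R_y,R_S$ with $\|X^*\|_{\mathrm F}\le R_X$, $\|y^*\|_1\le R_y$, $\|S^*\|_{\mathrm F}\le R_S$ for the primal-dual optimal triple $(X^*,y^*,S^* )$ considered. Let $\mathcal{X}=\{X\in\mathbb{S}^n: X\succeq0,\|X\|_{\mathrm F}\le R_X\}$, $\mathcal{Y}=\{y\in\mathbb{R}^m:\|y\|_1\le R_y\}$, $\mathcal{S}=\{S\in\mathbb{S}^n:S\succeq0,\|S\|_{\mathrm F}\le R_S\}$. $\mathrm{Proj}$ denotes the orthogonal (Frobenius/Euclidean) projection, and $\mathrm{Id}$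 the identity operator. **Scheme.** The penalty parameter is $\gamma=1$. For a real polynomial $g$ and $X=U\,\mathrm{diag}(\lambda_i)\,U^\top\in\mathbb{S}^n$, the spectral operator is $\boldsymbol{g}(X)=U\,\mathrm{diag}(g(\lambda_i))\,U^\top$. For $k=0,1,2,\dots$: - $\hat y^{k+1}=-(\mathcal{A}\mathcal{A}^* )^{-1}\big(\gamma(\mathcal{A}(X^k)-b)+\mathcal{A}(S^k-C)\big)$; - $\tilde y^{k+1}=\hat y^{k+1}+\Delta\tilde y^{k+1}$, $\|\Delta\tilde y^{k+1}\|_1\le\delta_{\tilde y}$; - $y^{k+1}=\mathrm{Proj}_{\mathcal{Y}}(\tilde y^{k+1}+\Delta y^{k+1})$, $\|\Delta y^{k+1}\|_1\le\delta_y$; - $\hat V^{k+1}=C-\mathcal{A}^*(\tilde y^{k+1})-\gamma X^k$; - $\tilde V^{k+1}=\hat V^{k+1}+\Delta V^{k+1}$, $\|\Delta V^{k+1}\|_{\mathrm F}\le\delta_V$; - $\tilde S^{k+1}=\boldsymbol{g}_1(\tilde V^{k+1})$, $S^{k+1}=\mathrm{Proj}_{\mathcal{S}}(\tilde S^{k+1}+\Delta S^{k+1})$, $\|\Delta S^{k+1}\|_{\mathrm F}\le\delta_S$; - $\tilde X^{k+1}=-\frac1\gamma\boldsymbol{g}_2(\tilde V^{k+1})$, $X^{k+1}=\mathrm{Proj}_{\mathcal{X}}(\tilde X^{k+1}+\Delta X^{k+1})$, $\|\Delta X^{k+1}\|_{\mathrm F}\le\delta_X$. Here the error terms are arbitrary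 subject to their bounds, and $\boldsymbol{g}_1,\boldsymbol{g}_2$ are polynomial spectral operators approximating $\mathrm{Proj}_{\mathbb{S}^n_+}$ and $\mathrm{Id}-\mathrm{Proj}_{\mathbb{S}^n_+}$ in the sense that in every iteration $\|\tilde S^{k+1}-\mathrm{Proj}_{\mathbb{S}^n_+}(\tilde V^{k+1})\|_2\le\delta_{\tilde S}$ and $\|\tilde X^{k+1}+\frac1\gamma(\mathrm{Id}-\mathrm{Proj}_{\mathbb{S}^n_+})(\tilde V^{k+1})\|_2\le\delta_{\tilde X}$ ($\|\cdot\|_2$ on matrices is the spectral norm). The constants implied by $\mathcal{O}$ and $\Theta$ do not depend on $K$ or on the tolerances $\delta_{\bullet}$; they may depend on the fixed problem data and the radii $R_X,R_y,R_S$.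
   Formalization: The residual bound is proved only when ‖X*‖_F < R_X (it fails for equality), with a constant that may depend on (X*,y*,S* ); the constant in the objective bound may also depend on the starting point (a constant uniform over starts is impossible). *)

theory Defs
  imports "HOL-Analysis.Analysis" "HOL-Computational_Algebra.Polynomial"
begin

text \<open>
  Matrices are elements of \<^typ>\<open>real^'n^'n\<close>; the library's \<^const>\<open>inner\<close> and \<^const>\<open>norm\<close> on this
  type are the trace inner product and the Frobenius norm.
\<close>

lemma inner_matrix_eq_trace:
  fixes A B :: "real^'n^'n"
  shows "inner A B = trace (transpose A ** B)"
  by (simp add: inner_vec_def trace_def transpose_def matrix_matrix_mult_def)
    (rule sum.swap)

definition sym_mat :: "real^'n^'n \<Rightarrow> bool" where
  "sym_mat M \<longleftrightarrow> transpose M = M"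

definition psd :: "real^'n^'n \<Rightarrow> bool" where
  "psd M \<longleftrightarrow> sym_mat M \<and> (\<forall>v. 0 \<le> inner v (M *v v))"

definition pos_def :: "real^'n^'n \<Rightarrow> bool" where
  "pos_def M \<longleftrightarrow> sym_mat M \<and> (\<forall>v. v \<noteq> 0 \<longrightarrow> 0 < inner v (M *v v))"

definition norm1 :: "real^'m \<Rightarrow> real" where
  "norm1 y = (\<Sum>i\<in>UNIV. \<bar>y $ i\<bar>)"

definition spectral_norm :: "real^'n^'n \<Rightarrow> real" where
  "spectral_norm M = onorm (\<lambda>v. M *v v)"

definition diag_mat :: "real^'n \<Rightarrow> real^'n^'n" where
  "diag_mat d = (\<chi> i j. if i = j then d $ i else 0)"

definition spectral_op :: "real poly \<Rightarrow> real^'n^'n \<Rightarrow> real^'n^'n" where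
  "spectral_op g M = (THE Y. \<exists>U d. orthogonal_matrix U
      \<and> M = U ** diag_mat d ** transpose U
      \<and> Y = U ** diag_mat (\<chi> i. poly g (d $ i)) ** transpose U)"

text \<open>The result does not depend on the chosen diagonalisation, so the description is proper.\<close>

lemma diag_mat_mult: "diag_mat c ** diag_mat d = diag_mat (\<chi> i. c $ i * d $ i)"
proof -
  have "(\<Sum>k\<in>UNIV. (if i = k then c $ i else 0) * (if k = j then d $ k else 0))
      = (if i = j then c $ i * d $ i else 0)" for i j :: 'a
  proof -
    have "(\<Sum>k\<in>UNIV. (if i = k then c $ i else 0) * (if k = j then d $ k else 0))
      = (\<Sum>k\<in>UNIV. if k = i then c $ i * (if k = j then d $ k else 0) else 0)"
      by (rule sum.cong) auto
    then show ?thesis by simp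
  qed
  then show ?thesis by (simp add: diag_mat_def matrix_matrix_mult_def vec_eq_iff)
qed

lemma spectral_pCons:
  fixes U :: "real^'n^'n"
  assumes "orthogonal_matrix U"
  shows "U ** diag_mat (\<chi> i. poly (pCons a p) (d $ i)) ** transpose U
    = a *\<^sub>R mat 1 + (U ** diag_mat d ** transpose U)
        ** (U ** diag_mat (\<chi> i. poly p (d $ i)) ** transpose U)"
proof -
  let ?P = "diag_mat (\<chi> i. poly p (d $ i))"
  have o: "transpose U ** U = mat 1" "U ** transpose U = mat 1"
    using assms by (auto simp: orthogonal_matrix_def)
  have split: "diag_mat (\<chi> i. poly (pCons a p) (d $ i)) = a *\<^sub>R mat 1 + diag_mat d ** ?P"
    unfolding diag_mat_mult by (simp add: diag_mat_def mat_def vec_eq_iff)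
  have "(U ** diag_mat d ** transpose U) ** (U ** ?P ** transpose U)
      = U ** diag_mat d ** (transpose U ** U) ** ?P ** transpose U"
    by (simp only: matrix_mul_assoc)
  also have "\<dots> = U ** (diag_mat d ** ?P) ** transpose U"
    by (simp only: o matrix_mul_rid matrix_mul_assoc)
  finally have 1: "(U ** diag_mat d ** transpose U) ** (U ** ?P ** transpose U)
      = U ** (diag_mat d ** ?P) ** transpose U" .
  have "U ** (a *\<^sub>R mat 1) = a *\<^sub>R U"
    by (metis matrix_mul_rid matrix_scalar_ac)
  then have 2: "U ** (a *\<^sub>R mat 1) ** transpose U = a *\<^sub>R mat 1"
    by (simp only: scalar_matrix_assoc[symmetric] o)
  have 3: "(M + N) ** T = M ** T + N ** T" for M N T :: "real^'n^'n"
    by (simp add: matrix_matrix_mult_def vec_eq_iff sum.distrib distrib_right)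
  show ?thesis
    unfolding split 1 matrix_add_ldistrib 3 2 ..
qed

lemma spectral_unique:
  fixes U U' :: "real^'n^'n"
  assumes "orthogonal_matrix U" "orthogonal_matrix U'"
    and "U ** diag_mat d ** transpose U = U' ** diag_mat d' ** transpose U'"
  shows "U ** diag_mat (\<chi> i. poly g (d $ i)) ** transpose U
    = U' ** diag_mat (\<chi> i. poly g (d' $ i)) ** transpose U'"
proof (induction g)
  case 0
  have "diag_mat (\<chi> i. poly 0 (e $ i)) = 0" for e :: "real^'n"
    by (simp add: diag_mat_def vec_eq_iff)
  then show ?case by (simp add: matrix_matrix_mult_def vec_eq_iff)
next
  case (pCons a p)
  show ?case
    unfolding spectral_pCons[OF assms(1)] spectral_pCons[OF assms(2)] assms(3) pCons.IH ..
qed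

lemma spectral_op_diagonalised:
  assumes "orthogonal_matrix U"
  shows "spectral_op g (U ** diag_mat d ** transpose U)
    = U ** diag_mat (\<chi> i. poly g (d $ i)) ** transpose U"
  unfolding spectral_op_def
proof (rule the_equality)
  show "\<exists>V e. orthogonal_matrix V
      \<and> U ** diag_mat d ** transpose U = V ** diag_mat e ** transpose V
      \<and> U ** diag_mat (\<chi> i. poly g (d $ i)) ** transpose U
        = V ** diag_mat (\<chi> i. poly g (e $ i)) ** transpose V"
    using assms by metis
next
  fix Y assume "\<exists>V e. orthogonal_matrix V
      \<and> U ** diag_mat d ** transpose U = V ** diag_mat e ** transpose V
      \<and> Y = V ** diag_mat (\<chi> i. poly g (e $ i)) ** transpose V"
  then obtain V e where V: "orthogonal_matrix V"
    and eq: "U ** diag_mat d ** transpose U = V ** diag_mat e ** transpose V"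
    and Y: "Y = V ** diag_mat (\<chi> i. poly g (e $ i)) ** transpose V"
    by auto
  show "Y = U ** diag_mat (\<chi> i. poly g (d $ i)) ** transpose U"
    unfolding Y by (rule spectral_unique[OF assms V eq, symmetric])
qed

definition opA :: "real^'n^'n^'m \<Rightarrow> real^'n^'n \<Rightarrow> real^'m" where
  "opA A M = (\<chi> i. inner (A $ i) M)"

definition adjA :: "real^'n^'n^'m \<Rightarrow> real^'m \<Rightarrow> real^'n^'n" where
  "adjA A y = (\<Sum>i\<in>UNIV. y $ i *\<^sub>R A $ i)"

definition gramA :: "real^'n^'n^'m \<Rightarrow> real^'m^'m" where
  "gramA A = (\<chi> i j. inner (A $ i) (A $ j))"

definition sdp_data :: "real^'n^'n^'m \<Rightarrow> real^'n^'n \<Rightarrow> bool" where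
  "sdp_data A C \<longleftrightarrow> (\<forall>i. sym_mat (A $ i) \<and> norm (A $ i) \<le> 1)
     \<and> sym_mat C \<and> norm C \<le> 1 \<and> pos_def (gramA A)"

definition sdp_optimal ::
  "real^'n^'n^'m \<Rightarrow> real^'m \<Rightarrow> real^'n^'n \<Rightarrow> real^'n^'n \<Rightarrow> real^'m \<Rightarrow> real^'n^'n \<Rightarrow> bool" where
  "sdp_optimal A b C X y S \<longleftrightarrow>
     opA A X = b \<and> psd X \<and> adjA A y + S = C \<and> psd S \<and> X ** S = 0"

definition psd_ball :: "real \<Rightarrow> (real^'n^'n) set" where
  "psd_ball R = {M. psd M \<and> norm M \<le> R}"

text \<open>
  The closest point is taken in the space of all matrices; at a symmetric matrix it is the
  projection within the symmetric matrices, since the target set consists of symmetric ones.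
\<close>

definition proj_psd :: "real^'n^'n \<Rightarrow> real^'n^'n" where
  "proj_psd = closest_point {M. psd M}"

record tolerances =
  tol_ytil :: real
  tol_y :: real
  tol_V :: real
  tol_S :: real
  tol_X :: real
  tol_Stil :: real
  tol_Xtil :: real

definition total_tol :: "tolerances \<Rightarrow> real" where
  "total_tol t = tol_ytil t + tol_y t + tol_V t + tol_X t + tol_S t + tol_Stil t + tol_Xtil t"

text \<open>
  The sequences of one run. \<open>it_X\<close>, \<open>it_y\<close>, \<open>it_S\<close> start at index 0; all other sequences
  are meaningful from index 1 on. The fields \<open>err_\<dots>\<close> are the perturbations \<open>\<Delta>\<dots>\<close>.
\<close>

record ('n::finite, 'm::finite) qadmm_run =
  it_yhat :: "nat \<Rightarrow> real^'m"
  it_ytil :: "nat \<Rightarrow> real^'m"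
  it_y :: "nat \<Rightarrow> real^'m"
  it_Vhat :: "nat \<Rightarrow> real^'n^'n"
  it_Vtil :: "nat \<Rightarrow> real^'n^'n"
  it_Stil :: "nat \<Rightarrow> real^'n^'n"
  it_S :: "nat \<Rightarrow> real^'n^'n"
  it_Xtil :: "nat \<Rightarrow> real^'n^'n"
  it_X :: "nat \<Rightarrow> real^'n^'n"
  err_ytil :: "nat \<Rightarrow> real^'m"
  err_y :: "nat \<Rightarrow> real^'m"
  err_V :: "nat \<Rightarrow> real^'n^'n"
  err_S :: "nat \<Rightarrow> real^'n^'n"
  err_X :: "nat \<Rightarrow> real^'n^'n"

definition qadmm_step ::
  "real \<Rightarrow> real^'n^'n^'m \<Rightarrow> real^'m \<Rightarrow> real^'n^'n \<Rightarrow> real \<Rightarrow> real \<Rightarrow> real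
   \<Rightarrow> real poly \<Rightarrow> real poly \<Rightarrow> tolerances \<Rightarrow> ('n, 'm) qadmm_run \<Rightarrow> nat \<Rightarrow> bool" where
  "qadmm_step \<gamma> A b C RX Ry RS g1 g2 t r k \<longleftrightarrow>
     it_yhat r (Suc k) = - (matrix_inv (gramA A)
         *v (\<gamma> *\<^sub>R (opA A (it_X r k) - b) + opA A (it_S r k - C)))
   \<and> it_ytil r (Suc k) = it_yhat r (Suc k) + err_ytil r (Suc k)
   \<and> norm1 (err_ytil r (Suc k)) \<le> tol_ytil t
   \<and> it_y r (Suc k) = closest_point {v. norm1 v \<le> Ry} (it_ytil r (Suc k) + err_y r (Suc k))
   \<and> norm1 (err_y r (Suc k)) \<le> tol_y t
   \<and> it_Vhat r (Suc k) = C - adjA A (it_ytil r (Suc k)) - \<gamma> *\<^sub>R it_X r k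
   \<and> it_Vtil r (Suc k) = it_Vhat r (Suc k) + err_V r (Suc k)
   \<and> sym_mat (err_V r (Suc k)) \<and> norm (err_V r (Suc k)) \<le> tol_V t
   \<and> it_Stil r (Suc k) = spectral_op g1 (it_Vtil r (Suc k))
   \<and> spectral_norm (it_Stil r (Suc k) - proj_psd (it_Vtil r (Suc k))) \<le> tol_Stil t
   \<and> it_S r (Suc k) = closest_point (psd_ball RS) (it_Stil r (Suc k) + err_S r (Suc k))
   \<and> sym_mat (err_S r (Suc k)) \<and> norm (err_S r (Suc k)) \<le> tol_S t
   \<and> it_Xtil r (Suc k) = - (1 / \<gamma>) *\<^sub>R spectral_op g2 (it_Vtil r (Suc k))
   \<and> spectral_norm (it_Xtil r (Suc k)
         + (1 / \<gamma>) *\<^sub>R (it_Vtil r (Suc k) - proj_psd (it_Vtil r (Suc k)))) \<le> tol_Xtil t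
   \<and> it_X r (Suc k) = closest_point (psd_ball RX) (it_Xtil r (Suc k) + err_X r (Suc k))
   \<and> sym_mat (err_X r (Suc k)) \<and> norm (err_X r (Suc k)) \<le> tol_X t"

definition is_qadmm_run ::
  "real \<Rightarrow> real^'n^'n^'m \<Rightarrow> real^'m \<Rightarrow> real^'n^'n \<Rightarrow> real \<Rightarrow> real \<Rightarrow> real
   \<Rightarrow> real poly \<Rightarrow> real poly \<Rightarrow> tolerances
   \<Rightarrow> real^'n^'n \<Rightarrow> real^'m \<Rightarrow> real^'n^'n \<Rightarrow> ('n, 'm) qadmm_run \<Rightarrow> bool" where
  "is_qadmm_run \<gamma> A b C RX Ry RS g1 g2 t X0 y0 S0 r \<longleftrightarrow>
     it_X r 0 = X0 \<and> it_y r 0 = y0 \<and> it_S r 0 = S0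
   \<and> (\<forall>k. qadmm_step \<gamma> A b C RX Ry RS g1 g2 t r k)"

definition ergodic_avg :: "nat \<Rightarrow> (nat \<Rightarrow> 'v::real_vector) \<Rightarrow> 'v" where
  "ergodic_avg K u = (1 / real K) *\<^sub>R (\<Sum>k=1..K. u k)"

definition dual_obj :: "real^'m \<Rightarrow> real^'m \<Rightarrow> real" where
  "dual_obj b y = - inner b y"

end

theory Submission
  imports Defs
begin

text \<open>
  The state of the method is the pair \<open>(X, S)\<close>; everything else is a function of it. One step with
  exact arithmetic computes \<open>y\<close>, splits \<open>V = C - A*(y) - X\<close> into its positive part \<open>S'\<close> and its
  negative part \<open>X'\<close>, and has residual \<open>A*(y) + S' - C = X' - X\<close>. Two facts about such a step
  carry the proof.

  \<^item> It does not increase the distance of \<open>(X, S)\<close> to \<open>(X*, S*)\<close> (\<open>exact_step_contracts\<close>). The normal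
    equation for \<open>y\<close> says that \<open>w = A*(y - y*)\<close> is orthogonal to \<open>(X - X*) + (S - S*) + w\<close>, which
    bounds the distance of \<open>V\<close> to \<open>S* - X*\<close>; and taking positive and negative parts is nonexpansive,
    because the cone of positive semidefinite matrices is self-dual.

  \<^item> The objective gap is at most the decrease of \<open>|X|^2 / 2 + |S - S*|^2 / 2\<close>
    (\<open>exact_step_objective\<close>).

  The iteration deviates from the exact step in two ways. The perturbations move \<open>X'\<close> and \<open>S'\<close> by at
  most \<open>\<epsilon>\<close>, a fixed multiple of the total tolerance, since all projections are nonexpansive. The
  matrices are then truncated to balls around 0; this neither increases the distance to the
  solution nor the norm of \<open>X\<close>, so both facts survive truncation. As the truncated iterates are
  bounded, perturbing them costs only \<open>O(\<epsilon>)\<close> in the squared norms, for large \<open>\<epsilon>\<close> as well as for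
  small.

  Summing the objective gaps leaves \<open>(|X0|^2 - |XK|^2) / 2 \<le> |X0| |XK - X0|\<close>, where the last factor
  is at most twice the initial distance \<open>d\<close> plus the accumulated error. The claimed rate has \<open>d^2\<close>
  instead of \<open>d\<close>; since its constant may depend on the starting point, \<open>d = d^2 / d\<close> settles this,
  and the case \<open>d = 0\<close> is covered too.

  The residuals would telescope if \<open>X'\<close> were the next iterate, so what remains is the sum of the
  lengths cut off by truncation. Here \<open>|X*| < R_X\<close> enters: cutting off a length \<open>t\<close> lowers the
  squared distance to the solution by at least \<open>2 (R_X - |X*|) t\<close>
  (\<open>closest_point_cone_cball_gain\<close>), so the total is bounded by a squared distance. To get a bound
  that is linear in \<open>d\<close> with a constant valid for all starting points, the first step is treated
  separately: it cuts off at most \<open>d\<close>, and afterwards the distance is bounded by the radii, which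
  makes its square at most a constant times \<open>d + 2\<epsilon>\<close>.
\<close>

section \<open>Projections onto closed convex cones\<close>

text \<open>
  Moreau's decomposition: the residual of a projection onto a cone is orthogonal to the projection
  and lies in the dual cone. Both follow from the variational inequality of the projection, tested at
  \<open>0\<close> and at twice the projection.
\<close>

lemma closest_point_cone:
  fixes K :: "'a::euclidean_space set"
  assumes K: "closed K" "convex K" "cone K" "K \<noteq> {}"
  shows inner_closest_point_cone_residual:
      "inner (closest_point K v) (closest_point K v - v) = 0"
    and closest_point_cone_residual_dual:
      "z \<in> K \<Longrightarrow> 0 \<le> inner z (closest_point K v - v)"
proof -
  define p where "p = closest_point K v"
  have p: "p \<in> K" unfolding p_def by (rule closest_point_in_set[OF K(1,4)])
  have var: "inner (v - p) (z - p) \<le> 0" if "z \<in> K" for z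
    unfolding p_def by (rule closest_point_dot[OF K(2,1) that])
  have "0 \<in> K" using K(3,4) cone_contains_0 by blast
  moreover have "2 *\<^sub>R p \<in> K" using p K(3) by (simp add: cone_def)
  ultimately have "inner (v - p) (0 - p) \<le> 0" "inner (v - p) (2 *\<^sub>R p - p) \<le> 0"
    using var by blast+
  then have orth: "inner p (p - v) = 0"
    by (simp add: inner_diff_left inner_diff_right inner_commute)
  then show "inner (closest_point K v) (closest_point K v - v) = 0" by (simp add: p_def)
  show "0 \<le> inner z (closest_point K v - v)" if "z \<in> K"
    using var[OF that] orth unfolding p_def[symmetric]
    by (simp add: inner_diff_left inner_diff_right inner_commute)
qed

text \<open>
  On the cone, projecting to the truncated cone is radial shrinking, so \<open>w - q\<close> is a multiple of
  \<open>w\<close>. If anything is cut off, \<open>z\<close> lies at least \<open>R - norm z\<close> behind the hyperplane through \<open>q\<close>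
  orthogonal to \<open>w\<close>, and that margin is gained on top of nonexpansiveness.
\<close>

lemma closest_point_cone_cball_gain:
  fixes K :: "'a::euclidean_space set"
  assumes K: "closed K" "convex K" "cone K" and w: "w \<in> K" and z: "norm z \<le> R"
  defines "q \<equiv> closest_point (K \<inter> cball 0 R) w"
  shows "2 * (R - norm z) * norm (w - q) \<le> (norm (w - z))\<^sup>2 - (norm (q - z))\<^sup>2"
proof (cases "norm w \<le> R")
  case True
  then have "q = w" unfolding q_def using w by (intro closest_point_self) auto
  then show ?thesis by simp
next
  case False
  have R: "0 \<le> R" using z norm_ge_zero order_trans by blast
  have w0: "norm w > 0" using False R by linarith
  define s where "s = R / norm w"
  have s: "0 \<le> s" "s \<le> 1" "s * norm w = R" using False R w0 by (auto simp: s_def)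
  have "s *\<^sub>R w = q" unfolding q_def
  proof (rule closest_point_unique)
    show "convex (K \<inter> cball 0 R)" "closed (K \<inter> cball 0 R)"
      using K by (auto intro: convex_Int closed_Int)
    show "s *\<^sub>R w \<in> K \<inter> cball 0 R" using w K(3) s by (auto simp: cone_def)
    show "\<forall>z\<in>K \<inter> cball 0 R. dist w (s *\<^sub>R w) \<le> dist w z"
    proof
      fix u assume "u \<in> K \<inter> cball 0 R"
      then have "norm w - R \<le> norm (w - u)" using norm_triangle_ineq2[of w u] by simp
      moreover have "norm (w - s *\<^sub>R w) = norm w - R"
      proof -
        have "w - s *\<^sub>R w = (1 - s) *\<^sub>R w" by (simp add: algebra_simps)
        then have "norm (w - s *\<^sub>R w) = (1 - s) * norm w" using s by simp
        then show ?thesis using s by (simp add: algebra_simps)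
      qed
      ultimately show "dist w (s *\<^sub>R w) \<le> dist w u" by (simp add: dist_norm)
    qed
  qed
  then have q: "q = s *\<^sub>R w" ..
  have wq: "w - q = (1 - s) *\<^sub>R w" by (simp add: q algebra_simps)
  have nwq: "norm (w - q) = (1 - s) * norm w" using s unfolding wq by simp
  have "(R - norm z) * norm w \<le> inner w (q - z)"
  proof -
    have "inner w q = R * norm w"
      using s(3) by (metis q inner_scaleR_right power2_norm_eq_inner power2_eq_square mult.assoc)
    moreover have "inner w z \<le> norm w * norm z" by (rule norm_cauchy_schwarz)
    ultimately show ?thesis by (simp add: inner_diff_right algebra_simps)
  qed
  then have "(1 - s) * ((R - norm z) * norm w) \<le> (1 - s) * inner w (q - z)"
    using s by (intro mult_left_mono) auto
  then have le: "(R - norm z) * norm (w - q) \<le> inner (w - q) (q - z)"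
    unfolding nwq unfolding wq by (simp only: inner_scaleR_left mult_ac)
  have "(norm (w - z))\<^sup>2 - (norm (q - z))\<^sup>2 = (norm (w - q))\<^sup>2 + 2 * inner (w - q) (q - z)"
    by (simp add: power2_norm_eq_inner inner_diff_left inner_diff_right inner_commute)
  moreover have "0 \<le> (norm (w - q))\<^sup>2" by simp
  ultimately show ?thesis using le by linarith
qed

section \<open>The cone of positive semidefinite matrices\<close>

lemma inner_matrix_vector_sum:
  fixes M :: "real^'n^'n"
  shows "inner u (M *v v) = (\<Sum>i\<in>UNIV. \<Sum>j\<in>UNIV. u $ i * M $ i $ j * v $ j)"
  by (simp add: inner_vec_def matrix_vector_mult_def sum_distrib_left mult_ac)

lemma sym_mat_inner_commute:
  fixes M :: "real^'n^'n"
  assumes "sym_mat M"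
  shows "inner u (M *v v) = inner v (M *v u)"
  using assms by (metis sym_mat_def dot_lmul_matrix inner_commute transpose_matrix_vector)

lemma closed_psd: "closed {M :: real^'n^'n. psd M}"
proof -
  have "{M :: real^'n^'n. psd M} = (\<Inter>i. \<Inter>j. {M. M $ j $ i = M $ i $ j})
      \<inter> (\<Inter>v. {M. 0 \<le> (\<Sum>i\<in>UNIV. \<Sum>j\<in>UNIV. v $ i * M $ i $ j * v $ j)})"
    by (auto simp: psd_def sym_mat_def inner_matrix_vector_sum transpose_def vec_eq_iff)
  then show ?thesis
    by (auto intro!: closed_Int closed_INT closed_Collect_eq closed_Collect_le continuous_intros)
qed

lemma sym_mat_add: "sym_mat M \<Longrightarrow> sym_mat N \<Longrightarrow> sym_mat (M + N)"
  and sym_mat_diff: "sym_mat M \<Longrightarrow> sym_mat N \<Longrightarrow> sym_mat (M - N)"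
  and sym_mat_scaleR: "sym_mat M \<Longrightarrow> sym_mat (c *\<^sub>R M)"
  by (simp_all add: sym_mat_def transpose_def vec_eq_iff)

lemma psd_add: "psd M \<Longrightarrow> psd N \<Longrightarrow> psd (M + N)"
  by (simp add: psd_def sym_mat_add matrix_vector_mult_add_rdistrib inner_add_right)

lemma psd_scaleR: "0 \<le> c \<Longrightarrow> psd M \<Longrightarrow> psd (c *\<^sub>R M)"
  by (simp add: psd_def sym_mat_scaleR scaleR_matrix_vector_assoc[symmetric])

lemma cone_psd: "cone {M :: real^'n^'n. psd M}"
  by (auto simp: cone_def psd_scaleR)

lemma convex_psd: "convex {M :: real^'n^'n. psd M}"
  by (auto simp: convex_def intro: psd_add psd_scaleR)

definition outer :: "real^'n \<Rightarrow> real^'n^'n" where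
  "outer u = (\<chi> i j. u $ i * u $ j)"

lemma outer_mult_vector: "outer u *v v = inner u v *\<^sub>R u"
  by (simp add: outer_def matrix_vector_mult_def inner_vec_def vec_eq_iff sum_distrib_left mult_ac)

lemma inner_outer: "inner M (outer u) = inner u (M *v u)"
  unfolding inner_matrix_vector_sum by (simp add: inner_vec_def outer_def mult_ac)

lemma sym_mat_outer: "sym_mat (outer u)"
  by (simp add: sym_mat_def outer_def transpose_def vec_eq_iff mult.commute)

lemma psd_outer: "psd (outer u)"
  by (simp add: psd_def sym_mat_outer outer_mult_vector inner_commute)

text \<open>
  Moving from \<open>M *v v\<close> along the isotropic direction \<open>v\<close> changes the quadratic form affinely, with
  slope proportional to the squared norm of \<open>M *v v\<close>. A nonnegative affine function is constant.
\<close>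

lemma psd_isotropic_kernel:
  fixes M :: "real^'n^'n"
  assumes M: "psd M" and v: "inner v (M *v v) = 0"
  shows "M *v v = 0"
proof -
  have sym: "sym_mat M" using M by (simp add: psd_def)
  define w where "w = M *v v"
  define q where "q = inner w (M *v w)"
  have q: "0 \<le> q" using M by (simp add: q_def psd_def)
  have "2 * t * inner w w \<le> q" for t
  proof -
    have "M *v (w - t *\<^sub>R v) = M *v w - t *\<^sub>R w"
      by (simp add: matrix_vector_mult_diff_distrib matrix_vector_mult_scaleR w_def)
    moreover have "inner v (M *v w) = inner w w"
      using sym_mat_inner_commute[OF sym, of v w] by (simp add: w_def)
    moreover have "inner v w = 0" using v by (simp add: w_def)
    ultimately have "inner (w - t *\<^sub>R v) (M *v (w - t *\<^sub>R v)) = q - 2 * t * inner w w"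
      by (simp add: q_def inner_diff_left inner_diff_right)
    moreover have "0 \<le> inner (w - t *\<^sub>R v) (M *v (w - t *\<^sub>R v))"
      using M by (simp add: psd_def)
    ultimately show ?thesis by simp
  qed
  note bound = this
  have "inner w w = 0"
  proof (rule ccontr)
    assume "inner w w \<noteq> 0"
    then have "2 * ((q + 1) / (2 * inner w w)) * inner w w = q + 1" by simp
    with bound[of "(q + 1) / (2 * inner w w)"] show False by linarith
  qed
  then show ?thesis by (simp add: w_def)
qed

text \<open>
  The second matrix is
  reduced to rank one pieces by Cholesky elimination: subtracting \<open>u u^T / a\<close>, where \<open>u\<close> is its
  \<open>i\<close>-th column and \<open>a\<close> the pivot, keeps it positive semidefinite (a Schur complement), clears
  column \<open>i\<close> and leaves zero columns zero, so the number of nonzero columns drops. On a rank one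
  piece the inner product is a value of the quadratic form of the first matrix.
\<close>

lemma inner_psd_nonneg:
  fixes M N :: "real^'n^'n"
  assumes M: "psd M" and N: "psd N"
  shows "0 \<le> inner M N"
  using N
proof (induction "card {i. N *v axis i 1 \<noteq> 0}" arbitrary: N rule: less_induct)
  case less
  show ?case
  proof (cases "N = 0")
    case False
    have sym: "sym_mat N" using less.prems by (simp add: psd_def)
    have "\<exists>i. N *v axis i 1 \<noteq> 0"
      using False by (auto simp: matrix_vector_mul_component vec_eq_iff matrix_vector_mult_basis column_def)
    then obtain i where i: "N *v axis i 1 \<noteq> 0" ..
    define e where "e = (axis i 1 :: real^'n)"
    define a where "a = inner e (N *v e)"
    have a: "0 < a"
    proof -
      have "0 \<le> a" using less.prems by (simp add: psd_def a_def)
      moreover have "a \<noteq> 0" using psd_isotropic_kernel[OF less.prems, of e] i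
        by (auto simp: a_def e_def)
      ultimately show ?thesis by simp
    qed
    define u where "u = N *v e"
    define N' where "N' = N - (1 / a) *\<^sub>R outer u"
    have N'v: "N' *v v = N *v v - (inner u v / a) *\<^sub>R u" for v
      by (simp add: N'_def matrix_vector_mult_diff_rdistrib scaleR_matrix_vector_assoc[symmetric]
          outer_mult_vector)
    have swap: "inner e (N *v v) = inner u v" for v
      using sym_mat_inner_commute[OF sym, of e v] by (simp add: u_def inner_commute)
    have psd': "psd N'"
      unfolding psd_def
    proof (intro conjI allI)
      show "sym_mat N'" unfolding N'_def by (intro sym_mat_diff sym sym_mat_scaleR sym_mat_outer)
      fix v
      define t where "t = inner u v / a"
      \<comment> \<open>This \<open>t\<close> minimises the quadratic form of \<open>N\<close> along the line through \<open>v\<close> with direction \<open>e\<close>.\<close>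
      have "0 \<le> inner (v - t *\<^sub>R e) (N *v (v - t *\<^sub>R e))"
        using less.prems by (simp add: psd_def)
      also have "\<dots> = inner v (N *v v) - 2 * t * inner u v + t * t * a"
        by (simp add: matrix_vector_mult_diff_distrib matrix_vector_mult_scaleR inner_diff_left
            inner_diff_right swap u_def[symmetric] a_def inner_commute algebra_simps)
      also have "\<dots> = inner v (N' *v v)"
        using a by (simp add: N'v inner_diff_right t_def inner_commute field_simps)
      finally show "0 \<le> inner v (N' *v v)" .
    qed
    have "N' *v e = 0" using a by (simp add: N'v) (simp add: u_def a_def inner_commute)
    moreover have "N' *v axis j 1 = 0" if "N *v axis j 1 = 0" for j
    proof -
      have "inner u (axis j 1) = inner e (N *v axis j 1)" by (simp add: swap)
      then show ?thesis by (simp add: N'v that)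
    qed
    ultimately have "{j. N' *v axis j 1 \<noteq> 0} \<subset> {j. N *v axis j 1 \<noteq> 0}"
      using i by (auto simp: e_def)
    then have "card {j. N' *v axis j 1 \<noteq> 0} < card {j. N *v axis j 1 \<noteq> 0}"
      by (intro psubset_card_mono) auto
    then have "0 \<le> inner M N'" using less.hyps psd' by blast
    moreover have "0 \<le> inner M (outer u)" using M by (simp add: inner_outer psd_def)
    ultimately show ?thesis using a by (simp add: N'_def inner_diff_right)
      (smt (verit) divide_nonneg_pos)
  qed simp
qed

text \<open>
  The other half of self-duality: rank one matrices as test matrices recover the quadratic form.
\<close>

lemma psd_if_dual:
  assumes "sym_mat M" and "\<And>N. psd N \<Longrightarrow> 0 \<le> inner N M"
  shows "psd M"
  unfolding psd_def using assms(1) assms(2)[OF psd_outer]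
  by (simp add: inner_commute[of "outer _"] inner_outer)

lemma psd_zero: "psd 0" by (simp add: psd_def sym_mat_def transpose_def vec_eq_iff)

lemma psd_ball_eq: "psd_ball R = {M. psd M} \<inter> cball 0 R"
  by (auto simp: psd_ball_def)

lemma closed_psd_ball: "closed (psd_ball R)"
  unfolding psd_ball_eq by (intro closed_Int closed_psd closed_cball)

lemma convex_psd_ball: "convex (psd_ball R)"
  unfolding psd_ball_eq by (intro convex_Int convex_psd convex_cball)

lemma closest_point_psd_ball:
  fixes Z :: "real^'n^'n"
  assumes "Z \<in> psd_ball R"
  shows closest_point_psd_ball_in: "closest_point (psd_ball R) M \<in> psd_ball R"
    and closest_point_psd_ball_nonexpansive:
      "norm (closest_point (psd_ball R) M - closest_point (psd_ball R) N) \<le> norm (M - N)"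
    and closest_point_psd_ball_Fejer:
      "norm (closest_point (psd_ball R) M - Z) \<le> norm (M - Z)"
proof -
  have ne: "psd_ball R \<noteq> ({} :: (real^'n^'n) set)" using assms by auto
  show "closest_point (psd_ball R) M \<in> psd_ball R"
    by (rule closest_point_in_set[OF closed_psd_ball ne])
  show nonexp: "norm (closest_point (psd_ball R) M - closest_point (psd_ball R) N) \<le> norm (M - N)"
    for N
    using closest_point_lipschitz[OF convex_psd_ball closed_psd_ball ne] by (simp add: dist_norm)
  show "norm (closest_point (psd_ball R) M - Z) \<le> norm (M - Z)"
    using nonexp[of Z] by (simp add: closest_point_self[OF assms])
qed

lemma proj_psd:
  fixes M :: "real^'n^'n"
  shows psd_proj_psd: "psd (proj_psd M)"
    and proj_psd_nonexpansive: "norm (proj_psd M - proj_psd N) \<le> norm (M - N)"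
    and inner_proj_psd_residual: "inner (proj_psd M) (proj_psd M - M) = 0"
    and proj_psd_residual_dual: "psd Z \<Longrightarrow> 0 \<le> inner Z (proj_psd M - M)"
proof -
  have ne: "{M :: real^'n^'n. psd M} \<noteq> {}" using psd_zero by auto
  show "psd (proj_psd M)"
    unfolding proj_psd_def using closest_point_in_set[OF closed_psd ne] by auto
  show "norm (proj_psd M - proj_psd N) \<le> norm (M - N)"
    unfolding proj_psd_def using closest_point_lipschitz[OF convex_psd closed_psd ne]
    by (simp add: dist_norm)
  show "inner (proj_psd M) (proj_psd M - M) = 0"
    unfolding proj_psd_def
    by (rule inner_closest_point_cone_residual[OF closed_psd convex_psd cone_psd ne])
  show "0 \<le> inner Z (proj_psd M - M)" if "psd Z"
    unfolding proj_psd_def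
    by (rule closest_point_cone_residual_dual[OF closed_psd convex_psd cone_psd ne])
      (simp add: that)
qed

lemma psd_proj_psd_residual:
  assumes "sym_mat M"
  shows "psd (proj_psd M - M)"
proof (rule psd_if_dual)
  show "sym_mat (proj_psd M - M)"
    using assms psd_proj_psd[of M] by (intro sym_mat_diff) (auto simp: psd_def)
qed (rule proj_psd_residual_dual)

text \<open>
  Each entry is at most the spectral norm, and there are \<open>n^2\<close> entries. A crude comparison will do: only
  a factor that depends on nothing but the dimension is needed.
\<close>

lemma norm_le_spectral_norm:
  fixes M :: "real^'n^'n"
  shows "norm M \<le> (real CARD('n))\<^sup>2 * spectral_norm M"
proof -
  have "norm M \<le> (\<Sum>i\<in>UNIV. norm (M $ i))"
    by (simp add: norm_vec_def L2_set_le_sum)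
  also have "\<dots> \<le> (\<Sum>i\<in>(UNIV::'n set). \<Sum>j\<in>(UNIV::'n set). \<bar>M $ i $ j\<bar>)"
    by (intro sum_mono norm_le_l1_cart)
  also have "\<dots> \<le> (\<Sum>i\<in>(UNIV::'n set). \<Sum>j\<in>(UNIV::'n set). spectral_norm M)"
    unfolding spectral_norm_def by (intro sum_mono matrix_component_le_onorm)
  finally show ?thesis by (simp add: power2_eq_square)
qed

section \<open>The constraint operator and its adjoint\<close>

lemma adjA_diff: "adjA A (y - z) = adjA A y - adjA A z"
  by (simp add: adjA_def scaleR_diff_left sum_subtractf)

lemma adjA_add: "adjA A (y + z) = adjA A y + adjA A z"
  by (simp add: adjA_def scaleR_add_left sum.distrib)

lemma adjA_scaleR: "adjA A (c *\<^sub>R y) = c *\<^sub>R adjA A y"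
  by (simp add: adjA_def scaleR_sum_right)

lemma adjA_sum: "adjA A (sum y I) = (\<Sum>k\<in>I. adjA A (y k))"
  by (induction I rule: infinite_finite_induct) (simp_all add: adjA_add adjA_def[of _ 0])

lemma opA_add: "opA A (M + N) = opA A M + opA A N"
  and opA_diff: "opA A (M - N) = opA A M - opA A N"
  by (simp_all add: opA_def vec_eq_iff inner_add_right inner_diff_right)

lemma inner_adjA: "inner (adjA A y) M = inner y (opA A M)"
  by (simp add: adjA_def inner_sum_left opA_def inner_vec_def[of y])

lemma opA_adjA: "opA A (adjA A y) = gramA A *v y"
  by (simp add: opA_def adjA_def gramA_def matrix_vector_mult_def vec_eq_iff inner_sum_right mult_ac)

lemma sym_mat_adjA:
  assumes "\<And>i. sym_mat (A $ i)"
  shows "sym_mat (adjA A y)"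
  using assms by (simp add: sym_mat_def adjA_def transpose_def vec_eq_iff)

lemma norm_adjA_le:
  assumes "\<And>i. norm (A $ i) \<le> 1"
  shows "norm (adjA A y) \<le> norm1 y"
  unfolding adjA_def norm1_def
  by (rule sum_norm_le) (use assms in \<open>simp add: mult_left_le\<close>)

lemma pos_def_mult_matrix_inv:
  fixes M :: "real^'m^'m"
  assumes "pos_def M"
  shows "M *v (matrix_inv M *v v) = v"
proof -
  have "x = 0" if "M *v x = 0" for x
    using assms that by (metis pos_def_def inner_zero_right less_irrefl)
  then have "invertible M"
    by (simp add: invertible_left_inverse matrix_left_invertible_ker)
  then have "M ** matrix_inv M = mat 1"
    unfolding invertible_def matrix_inv_def by (rule someI2_ex) blast
  then show ?thesis by (simp add: matrix_vector_mul_assoc)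
qed

section \<open>One exact step\<close>

locale sdp_solution =
  fixes A :: "real^'n^'n^'m" and b :: "real^'m" and C :: "real^'n^'n"
    and Xs :: "real^'n^'n" and ys :: "real^'m" and Ss :: "real^'n^'n"
  assumes data: "sdp_data A C" and optimal: "sdp_optimal A b C Xs ys Ss"
begin

definition y_step :: "real^'n^'n \<Rightarrow> real^'n^'n \<Rightarrow> real^'m" where
  "y_step X S = - (matrix_inv (gramA A) *v (opA A X - b + opA A (S - C)))"

definition V_step :: "real^'n^'n \<Rightarrow> real^'n^'n \<Rightarrow> real^'n^'n" where
  "V_step X S = C - adjA A (y_step X S) - X"

definition S_step :: "real^'n^'n \<Rightarrow> real^'n^'n \<Rightarrow> real^'n^'n" where
  "S_step X S = proj_psd (V_step X S)"

text \<open>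
  The positive and negative parts of \<open>V_step\<close> in the sense of Moreau: \<open>V_step = S_step - X_step\<close>.
\<close>

definition X_step :: "real^'n^'n \<Rightarrow> real^'n^'n \<Rightarrow> real^'n^'n" where
  "X_step X S = proj_psd (V_step X S) - V_step X S"

lemma optimality:
  shows opA_Xs: "opA A Xs = b" and psd_Xs: "psd Xs" and psd_Ss: "psd Ss"
    and C_eq: "C = adjA A ys + Ss" and complementary: "inner Xs Ss = 0"
proof -
  show "opA A Xs = b" "psd Xs" "psd Ss" "C = adjA A ys + Ss"
    using optimal by (auto simp: sdp_optimal_def)
  have "transpose Xs = Xs" "Xs ** Ss = 0"
    using optimal by (auto simp: sdp_optimal_def psd_def sym_mat_def)
  then show "inner Xs Ss = 0" by (simp add: inner_matrix_eq_trace trace_def)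
qed

lemma residual_eq: "adjA A (y_step X S) + S_step X S - C = X_step X S - X"
  by (simp add: X_step_def S_step_def V_step_def)

lemma y_step_normal_equation: "opA A (X + S + adjA A (y_step X S) - C) = b"
proof -
  have "opA A (adjA A (y_step X S)) = - (opA A X - b + opA A (S - C))"
    using data pos_def_mult_matrix_inv[of "gramA A"]
    by (simp add: opA_adjA y_step_def sdp_data_def vec.neg)
  then show ?thesis by (simp add: opA_add opA_diff)
qed

lemma psd_S_step: "psd (S_step X S)"
  by (simp add: S_step_def psd_proj_psd)

lemma X_step_dual: "psd Z \<Longrightarrow> 0 \<le> inner Z (X_step X S)"
  by (simp add: X_step_def proj_psd_residual_dual)

lemma inner_S_step_X_step: "inner (S_step X S) (X_step X S) = 0"
  by (simp add: S_step_def X_step_def inner_proj_psd_residual)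

lemma psd_X_step:
  assumes "sym_mat X"
  shows "psd (X_step X S)"
proof -
  have "sym_mat (V_step X S)"
    using data assms unfolding V_step_def by (auto simp: sdp_data_def intro!: sym_mat_diff sym_mat_adjA)
  then show ?thesis unfolding X_step_def by (rule psd_proj_psd_residual)
qed

text \<open>
  With \<open>w = A*(y - y*)\<close>, the difference of \<open>X' - X*\<close> and \<open>S' - S*\<close> is \<open>w + (X - X*)\<close>. The normal
  equation makes \<open>w\<close> orthogonal to \<open>(X - X*) + (S - S*) + w\<close>, so the square of its norm is
  \<open>|X - X*|^2 + |S - S*|^2 - |w + (S - S*)|^2\<close>. It exceeds
  \<open>|X' - X*|^2 + |S' - S*|^2\<close> by \<open>2 \<langle>S', X*\<rangle> + 2 \<langle>S*, X'\<rangle>\<close>, and self-duality of the cone makes both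
  inner products nonnegative.
\<close>

lemma exact_step_contracts:
  "norm (X_step X S - Xs, S_step X S - Ss) \<le> norm (X - Xs, S - Ss)"
proof -
  define w where "w = adjA A (y_step X S - ys)"
  have wA: "w = adjA A (y_step X S) + Ss - C" by (simp add: w_def adjA_diff C_eq)
  have "opA A ((X - Xs) + (S - Ss) + w) = 0"
    using y_step_normal_equation[of X S] opA_Xs unfolding wA
    by (simp add: opA_add opA_diff algebra_simps)
  then have orth: "inner w ((X - Xs) + (S - Ss) + w) = 0"
    by (simp only: w_def inner_adjA inner_zero_right)
  have split: "(X_step X S - Xs) - (S_step X S - Ss) = w + (X - Xs)"
    by (simp add: wA X_step_def S_step_def V_step_def algebra_simps)
  have cross: "inner (X_step X S - Xs) (S_step X S - Ss) \<le> 0"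
    using X_step_dual[OF psd_Ss, of X S] inner_psd_nonneg[OF psd_S_step[of X S] psd_Xs]
      inner_S_step_X_step[of X S] complementary
    by (simp add: inner_diff_left inner_diff_right inner_commute)
  have "(norm (X_step X S - Xs))\<^sup>2 + (norm (S_step X S - Ss))\<^sup>2
      \<le> (norm ((X_step X S - Xs) - (S_step X S - Ss)))\<^sup>2"
    using cross by (simp add: power2_norm_eq_inner[of "_ - (S_step X S - Ss)"]
      power2_norm_eq_inner[of "X_step X S - Xs"] power2_norm_eq_inner[of "S_step X S - Ss"]
      inner_diff_left[of "X_step X S - Xs"] inner_diff_right[of _ "X_step X S - Xs"] inner_commute)
  also have "\<dots> = (norm (X - Xs))\<^sup>2 + (norm (S - Ss))\<^sup>2 - (norm (w + (S - Ss)))\<^sup>2"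
    using orth unfolding split
    by (simp add: power2_norm_eq_inner inner_add_left inner_add_right inner_commute)
  finally show ?thesis by (simp add: norm_Pair) (smt (verit) zero_le_power2)
qed

text \<open>
  The normal equation turns \<open>b^T (y - y*)\<close> into the inner product of \<open>X' + S - S'\<close> with
  \<open>w = (X' - X) - (S' - S*)\<close>. Completing squares, the gap is the stated decrease minus
  \<open>|(X' - X) + (S - S')|^2 / 2\<close> and \<open>\<langle>S*, X'\<rangle>\<close>, both nonnegative. This works with
  \<open>X\<close> compared with \<open>0\<close> and not with \<open>X*\<close>: besides the telescoping squares, \<open>X'\<close> is paired only with
  \<open>S'\<close>, to which it is orthogonal, and with \<open>S*\<close>, where the sign is favourable.
\<close>

lemma exact_step_objective:
  "dual_obj b (y_step X S) - dual_obj b ys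
    \<le> ((norm X)\<^sup>2 - (norm (X_step X S))\<^sup>2) / 2
      + ((norm (S - Ss))\<^sup>2 - (norm (S_step X S - Ss))\<^sup>2) / 2"
proof -
  define X' where "X' = X_step X S"
  define S' where "S' = S_step X S"
  define w where "w = adjA A (y_step X S - ys)"
  have wA: "w = (X' - X) - (S' - Ss)"
    using residual_eq[of X S] by (simp add: w_def adjA_diff C_eq X'_def S'_def algebra_simps)
  have "inner b (y_step X S - ys) = inner (X' + S - S') w"
  proof -
    have "X' + S - S' = X + S + adjA A (y_step X S) - C"
      using residual_eq[of X S] by (simp add: X'_def S'_def algebra_simps)
    then have "opA A (X' + S - S') = b" by (simp only: y_step_normal_equation)
    then show ?thesis
      using inner_adjA[of A "y_step X S - ys" "X' + S - S'"] by (simp add: w_def inner_commute)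
  qed
  then have obj: "dual_obj b (y_step X S) - dual_obj b ys = - inner (X' + S - S') w"
    by (simp add: dual_obj_def inner_diff_right)
  have "inner S' X' = 0" "0 \<le> inner Ss X'"
    using inner_S_step_X_step X_step_dual[OF psd_Ss] by (simp_all add: X'_def S'_def)
  moreover have "- inner (X' + S - S') w
      = ((norm X)\<^sup>2 - (norm X')\<^sup>2) / 2 + ((norm (S - Ss))\<^sup>2 - (norm (S' - Ss))\<^sup>2) / 2
        + inner S' X' - inner Ss X' - (norm ((X' - X) + (S - S')))\<^sup>2 / 2"
    unfolding wA
    by (simp add: power2_norm_eq_inner inner_add_left inner_add_right inner_diff_left
        inner_diff_right inner_commute field_simps)
  moreover have "0 \<le> (norm ((X' - X) + (S - S')))\<^sup>2 / 2" by simp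
  ultimately show ?thesis unfolding obj X'_def[symmetric] S'_def[symmetric] by linarith
qed

lemma V_step_perturbation:
  assumes "norm1 e \<le> s" and "norm F \<le> t"
  shows "norm ((C - adjA A (y_step X S + e) - X + F) - V_step X S) \<le> s + t"
proof -
  have "(C - adjA A (y_step X S + e) - X + F) - V_step X S = F - adjA A e"
    by (simp add: V_step_def adjA_add algebra_simps)
  moreover have "norm (adjA A e) \<le> s"
    using norm_adjA_le[of A e] data assms(1) by (auto simp: sdp_data_def)
  ultimately show ?thesis
    using norm_triangle_ineq4[of F "adjA A e"] assms(2) by (simp only:)
qed

text \<open>
  All tolerances enter through the distance to the exact step. The errors in \<open>y\<close> and \<open>V\<close> move \<open>V\<close>;
  its positive part moves by as much and its negative part by at most twice as much. The polynomial
  approximations are measured in the spectral norm, which costs the factor \<open>n^2\<close>; the errors \<open>\<Delta>S\<close> and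
  \<open>\<Delta>X\<close> add once. Hence the factor \<open>n^2 + 2\<close>.
\<close>

lemma qadmm_step_near_exact:
  fixes r :: "('n, 'm) qadmm_run" and t :: tolerances
  assumes step: "qadmm_step 1 A b C RX Ry RS g1 g2 t r k"
    and radii: "norm Xs \<le> RX" "norm Ss \<le> RS"
  defines "\<epsilon> \<equiv> ((real CARD('n))\<^sup>2 + 2) * total_tol t"
    and "X' \<equiv> X_step (it_X r k) (it_S r k)" and "S' \<equiv> S_step (it_X r k) (it_S r k)"
  shows "it_yhat r (Suc k) = y_step (it_X r k) (it_S r k)"
    and "norm (it_Stil r (Suc k) - S') \<le> \<epsilon>"
    and "it_X r (Suc k) \<in> psd_ball RX"
    and "it_S r (Suc k) \<in> psd_ball RS"
    and "norm (it_X r (Suc k) - closest_point (psd_ball RX) X') \<le> \<epsilon>"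
    and "norm (it_S r (Suc k) - closest_point (psd_ball RS) S') \<le> \<epsilon>"
proof -
  let ?n2 = "(real CARD('n))\<^sup>2"
  let ?V = "V_step (it_X r k) (it_S r k)"
  let ?W = "it_Vtil r (Suc k)"
  note facts = step[unfolded qadmm_step_def]
  show yhat: "it_yhat r (Suc k) = y_step (it_X r k) (it_S r k)"
    using facts by (simp add: y_step_def)
  have sn: "0 \<le> spectral_norm M" for M :: "real^'n^'n"
    unfolding spectral_norm_def by (rule onorm_pos_le[OF matrix_vector_mul_bounded_linear])
  have n1: "0 \<le> norm1 v" for v :: "real^'m" by (simp add: norm1_def sum_nonneg)
  have nonneg: "0 \<le> tol_ytil t" "0 \<le> tol_y t" "0 \<le> tol_V t" "0 \<le> tol_S t" "0 \<le> tol_X t"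
      "0 \<le> tol_Stil t" "0 \<le> tol_Xtil t"
    using facts n1 sn norm_ge_zero by (meson order_trans)+
  have "?W = C - adjA A (y_step (it_X r k) (it_S r k) + err_ytil r (Suc k)) - it_X r k
      + err_V r (Suc k)"
    using facts by (simp only: yhat[symmetric] scaleR_one)
  then have W: "norm (?W - ?V) \<le> tol_ytil t + tol_V t"
    using facts V_step_perturbation[of "err_ytil r (Suc k)" "tol_ytil t" "err_V r (Suc k)" "tol_V t"]
    by (simp only:)
  have PW: "norm (proj_psd ?W - proj_psd ?V) \<le> tol_ytil t + tol_V t"
    using proj_psd_nonexpansive W by (rule order_trans)
  have "norm (it_Stil r (Suc k) - proj_psd ?W) \<le> ?n2 * tol_Stil t"
    using facts by (intro order_trans[OF norm_le_spectral_norm] mult_left_mono) auto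
  then have Stil: "norm (it_Stil r (Suc k) - S') \<le> ?n2 * tol_Stil t + (tol_ytil t + tol_V t)"
    unfolding S'_def S_step_def
    using norm_triangle_ineq[of "it_Stil r (Suc k) - proj_psd ?W" "proj_psd ?W - proj_psd ?V"] PW
    by simp
  have "norm (it_Xtil r (Suc k) + (?W - proj_psd ?W)) \<le> ?n2 * tol_Xtil t"
    using facts by (intro order_trans[OF norm_le_spectral_norm] mult_left_mono) auto
  moreover have "norm ((proj_psd ?W - proj_psd ?V) - (?W - ?V))
      \<le> (tol_ytil t + tol_V t) + (tol_ytil t + tol_V t)"
    by (rule order_trans[OF norm_triangle_ineq4 add_mono[OF PW W]])
  moreover have "it_Xtil r (Suc k) - X' = (it_Xtil r (Suc k) + (?W - proj_psd ?W))
      + ((proj_psd ?W - proj_psd ?V) - (?W - ?V))"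
    by (simp add: X'_def X_step_def)
  ultimately have Xtil:
    "norm (it_Xtil r (Suc k) - X')
      \<le> ?n2 * tol_Xtil t + ((tol_ytil t + tol_V t) + (tol_ytil t + tol_V t))"
    by (simp only: norm_triangle_mono)
  have \<epsilon>: "\<epsilon> = ?n2 * tol_ytil t + ?n2 * tol_y t + ?n2 * tol_V t + ?n2 * tol_X t + ?n2 * tol_S t
      + ?n2 * tol_Stil t + ?n2 * tol_Xtil t + 2 * tol_ytil t + 2 * tol_y t + 2 * tol_V t
      + 2 * tol_X t + 2 * tol_S t + 2 * tol_Stil t + 2 * tol_Xtil t"
    by (simp add: \<epsilon>_def total_tol_def algebra_simps)
  have scaled: "0 \<le> ?n2 * tol_ytil t" "0 \<le> ?n2 * tol_y t" "0 \<le> ?n2 * tol_V t"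
      "0 \<le> ?n2 * tol_X t" "0 \<le> ?n2 * tol_S t" "0 \<le> ?n2 * tol_Stil t" "0 \<le> ?n2 * tol_Xtil t"
    using nonneg by simp_all
  show "norm (it_Stil r (Suc k) - S') \<le> \<epsilon>"
    using Stil nonneg scaled unfolding \<epsilon> by linarith
  have S: "it_S r (Suc k) = closest_point (psd_ball RS) (it_Stil r (Suc k) + err_S r (Suc k))"
    and X: "it_X r (Suc k) = closest_point (psd_ball RX) (it_Xtil r (Suc k) + err_X r (Suc k))"
    and err: "norm (err_S r (Suc k)) \<le> tol_S t" "norm (err_X r (Suc k)) \<le> tol_X t"
    using facts by blast+
  have mem: "Xs \<in> psd_ball RX" "Ss \<in> psd_ball RS"
    using radii psd_Xs psd_Ss by (simp_all add: psd_ball_def)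
  show "it_X r (Suc k) \<in> psd_ball RX" "it_S r (Suc k) \<in> psd_ball RS"
    unfolding X S by (rule closest_point_psd_ball_in[OF mem(1)] closest_point_psd_ball_in[OF mem(2)])+
  have "norm (it_X r (Suc k) - closest_point (psd_ball RX) X')
      \<le> norm ((it_Xtil r (Suc k) - X') + err_X r (Suc k))"
    unfolding X
    by (rule order_trans[OF closest_point_psd_ball_nonexpansive[OF mem(1)]]) (simp add: algebra_simps)
  then show "norm (it_X r (Suc k) - closest_point (psd_ball RX) X') \<le> \<epsilon>"
    using norm_triangle_ineq[of "it_Xtil r (Suc k) - X'" "err_X r (Suc k)"] Xtil err(2) nonneg scaled
    unfolding \<epsilon> by linarith
  have "norm (it_S r (Suc k) - closest_point (psd_ball RS) S')
      \<le> norm ((it_Stil r (Suc k) - S') + err_S r (Suc k))"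
    unfolding S
    by (rule order_trans[OF closest_point_psd_ball_nonexpansive[OF mem(2)]]) (simp add: algebra_simps)
  then show "norm (it_S r (Suc k) - closest_point (psd_ball RS) S') \<le> \<epsilon>"
    using norm_triangle_ineq[of "it_Stil r (Suc k) - S'" "err_S r (Suc k)"] Stil err(1) nonneg scaled
    unfolding \<epsilon> by linarith
qed

end

section \<open>Accumulation of errors along a run\<close>

text \<open>
  The bound \<open>B\<close> on the larger number makes the loss linear in \<open>e\<close>: no term \<open>e\<^sup>2\<close> appears.
\<close>

lemma square_ge_minus_error:
  fixes x y e B :: real
  assumes "0 \<le> x" "x \<le> y + e" "x \<le> B" "0 \<le> y" "0 \<le> e"
  shows "x\<^sup>2 - 2 * B * e \<le> y\<^sup>2"
proof (cases "x \<le> y")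
  case True
  then have "x\<^sup>2 \<le> y\<^sup>2" using assms by (intro power_mono) auto
  moreover have "0 \<le> 2 * B * e" using assms by simp
  ultimately show ?thesis by linarith
next
  case False
  then have "(x - y) * (x + y) \<le> e * (2 * B)" using assms by (intro mult_mono) auto
  then show ?thesis by (simp add: power2_eq_square algebra_simps)
qed

text \<open>
  A run of the method, reduced to what the convergence proof uses: each state is, up to \<open>\<epsilon>\<close>, the
  truncation of an exact step from the previous state.
\<close>

locale inexact_run = sdp_solution A b C Xs ys Ss
  for A :: "real^'n^'n^'m" and b :: "real^'m" and C :: "real^'n^'n"
    and Xs :: "real^'n^'n" and ys :: "real^'m" and Ss :: "real^'n^'n" +
  fixes RX RS \<epsilon> :: real and X S :: "nat \<Rightarrow> real^'n^'n"
  assumes radii: "norm Xs \<le> RX" "norm Ss \<le> RS"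
    and sym_X0: "sym_mat (X 0)"
    and X_mem: "X (Suc k) \<in> psd_ball RX" and S_mem: "S (Suc k) \<in> psd_ball RS"
    and X_err: "norm (X (Suc k) - closest_point (psd_ball RX) (X_step (X k) (S k))) \<le> \<epsilon>"
    and S_err: "norm (S (Suc k) - closest_point (psd_ball RS) (S_step (X k) (S k))) \<le> \<epsilon>"
begin

definition gap :: "nat \<Rightarrow> real" where
  "gap k = norm (X k - Xs, S k - Ss)"

lemma gap_squared: "(gap k)\<^sup>2 = (norm (X k - Xs))\<^sup>2 + (norm (S k - Ss))\<^sup>2"
  by (simp add: gap_def norm_Pair)

lemma norm_le_gap: "norm (X k - Xs) \<le> gap k"
  by (simp add: gap_def norm_Pair real_le_rsqrt)

lemma gap_nonneg: "0 \<le> gap k" by (simp add: gap_def)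

lemma eps_nonneg: "0 \<le> \<epsilon>" using X_err norm_ge_zero order_trans by blast

lemma radii_nonneg: "0 \<le> RX" "0 \<le> RS"
  using radii norm_ge_zero order_trans by blast+

lemma solution_in_balls: "Xs \<in> psd_ball RX" "Ss \<in> psd_ball RS"
  using radii psd_Xs psd_Ss by (simp_all add: psd_ball_def)

lemma sym_X: "sym_mat (X k)"
  using sym_X0 X_mem by (cases k) (auto simp: psd_ball_def psd_def)

lemma norm_Suc_le:
  shows X_Suc_le: "Z \<in> psd_ball RX \<Longrightarrow> norm (X (Suc k) - Z) \<le> norm (X_step (X k) (S k) - Z) + \<epsilon>"
    and S_Suc_le: "Z \<in> psd_ball RS \<Longrightarrow> norm (S (Suc k) - Z) \<le> norm (S_step (X k) (S k) - Z) + \<epsilon>"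
proof -
  let ?P = "closest_point (psd_ball RX) (X_step (X k) (S k))"
  let ?Q = "closest_point (psd_ball RS) (S_step (X k) (S k))"
  show "norm (X (Suc k) - Z) \<le> norm (X_step (X k) (S k) - Z) + \<epsilon>" if "Z \<in> psd_ball RX"
    using norm_triangle_ineq[of "X (Suc k) - ?P" "?P - Z"] X_err[of k]
      closest_point_psd_ball_Fejer[OF that, of "X_step (X k) (S k)"] by simp
  show "norm (S (Suc k) - Z) \<le> norm (S_step (X k) (S k) - Z) + \<epsilon>" if "Z \<in> psd_ball RS"
    using norm_triangle_ineq[of "S (Suc k) - ?Q" "?Q - Z"] S_err[of k]
      closest_point_psd_ball_Fejer[OF that, of "S_step (X k) (S k)"] by simp
qed

lemma gap_Suc_le: "gap (Suc k) \<le> gap k + 2 * \<epsilon>"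
proof -
  let ?P = "closest_point (psd_ball RX) (X_step (X k) (S k))"
  let ?Q = "closest_point (psd_ball RS) (S_step (X k) (S k))"
  have "gap (Suc k) = norm ((?P - Xs, ?Q - Ss) + (X (Suc k) - ?P, S (Suc k) - ?Q))"
    by (simp add: gap_def)
  also have "\<dots> \<le> norm (?P - Xs, ?Q - Ss) + norm (X (Suc k) - ?P, S (Suc k) - ?Q)"
    by (rule norm_triangle_ineq)
  also have "norm (X (Suc k) - ?P, S (Suc k) - ?Q) \<le> 2 * \<epsilon>"
    using norm_Pair_le[of "X (Suc k) - ?P" "S (Suc k) - ?Q"] X_err[of k] S_err[of k] by linarith
  also have "norm (?P - Xs, ?Q - Ss) \<le> norm (X_step (X k) (S k) - Xs, S_step (X k) (S k) - Ss)"
    unfolding norm_Pair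
    by (intro real_sqrt_le_mono add_mono power_mono norm_ge_zero
        closest_point_psd_ball_Fejer solution_in_balls)
  also have "\<dots> \<le> gap k"
    unfolding gap_def by (rule exact_step_contracts)
  finally show ?thesis by simp
qed

lemma gap_le: "gap k \<le> gap 0 + 2 * real k * \<epsilon>"
proof (induction k)
  case (Suc k)
  then show ?case using gap_Suc_le[of k] by (simp add: algebra_simps)
qed simp

lemma norm_X_diff_le: "norm (X k - X 0) \<le> 2 * gap 0 + 2 * real k * \<epsilon>"
  using norm_triangle_ineq4[of "X k - Xs" "X 0 - Xs"] norm_le_gap[of k] norm_le_gap[of 0]
    gap_le[of k] by simp

lemma objective_sum_telescopes:
  "(\<Sum>k<K. dual_obj b (y_step (X k) (S k)) - dual_obj b ys)
    \<le> ((norm (X 0))\<^sup>2 - (norm (X K))\<^sup>2) / 2 + ((norm (S 0 - Ss))\<^sup>2 - (norm (S K - Ss))\<^sup>2) / 2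
      + real K * ((RX + 2 * RS) * \<epsilon>)"
proof (induction K)
  case (Suc k)
  \<comment> \<open>The truncated cone contains \<open>0\<close>, so truncation does not increase the norm.\<close>
  have "0 \<in> psd_ball RX" using radii_nonneg psd_zero by (simp add: psd_ball_def)
  from X_Suc_le[OF this, of k]
  have x: "(norm (X (Suc k)))\<^sup>2 - 2 * RX * \<epsilon> \<le> (norm (X_step (X k) (S k)))\<^sup>2"
    using X_mem[of k] eps_nonneg by (intro square_ge_minus_error) (auto simp: psd_ball_def)
  have "norm (S (Suc k) - Ss) \<le> 2 * RS"
    using norm_triangle_ineq4[of "S (Suc k)" Ss] S_mem[of k] radii by (simp add: psd_ball_def)
  then have s: "(norm (S (Suc k) - Ss))\<^sup>2 - 2 * (2 * RS) * \<epsilon> \<le> (norm (S_step (X k) (S k) - Ss))\<^sup>2"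
    using S_Suc_le[OF solution_in_balls(2), of k] eps_nonneg by (intro square_ge_minus_error) auto
  show ?case
    using Suc.IH exact_step_objective[of "X k" "S k"] x s by (simp add: algebra_simps diff_divide_distrib)
qed simp

text \<open>
  When the run starts at the solution, \<open>inverse (gap 0) = 0\<close>, and the first term vanishes as it
  should; otherwise \<open>inverse (gap 0) * (gap 0)\<^sup>2 = gap 0\<close>.
\<close>

lemma objective_sum_le:
  "(\<Sum>k<K. dual_obj b (y_step (X k) (S k)) - dual_obj b ys)
    \<le> (2 * norm (X 0) * inverse (gap 0) + 1 / 2) * (gap 0)\<^sup>2
      + real K * ((2 * norm (X 0) + RX + 2 * RS) * \<epsilon>)"
proof -
  have "(norm (X 0))\<^sup>2 - 2 * norm (X 0) * norm (X K - X 0) \<le> (norm (X K))\<^sup>2"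
    using norm_triangle_ineq2[of "X 0" "X K"]
    by (intro square_ge_minus_error) (auto simp: norm_minus_commute)
  then have "(norm (X 0))\<^sup>2 - 2 * (norm (X 0) * norm (X K - X 0)) \<le> (norm (X K))\<^sup>2"
    by (simp add: mult.assoc)
  moreover have "norm (X 0) * norm (X K - X 0)
      \<le> 2 * (norm (X 0) * gap 0) + 2 * (real K * (norm (X 0) * \<epsilon>))"
    using mult_left_mono[OF norm_X_diff_le[of K] norm_ge_zero[of "X 0"]]
    by (simp add: algebra_simps)
  moreover have "(norm (S 0 - Ss))\<^sup>2 \<le> (gap 0)\<^sup>2" by (simp add: gap_squared)
  ultimately have "((norm (X 0))\<^sup>2 - (norm (X K))\<^sup>2) / 2
      + ((norm (S 0 - Ss))\<^sup>2 - (norm (S K - Ss))\<^sup>2) / 2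
      \<le> 2 * (norm (X 0) * gap 0) + 2 * (real K * (norm (X 0) * \<epsilon>)) + (gap 0)\<^sup>2 / 2"
    using zero_le_power2[of "norm (S K - Ss)"]
    by (simp only: diff_divide_distrib)
  moreover have "inverse (gap 0) * (gap 0)\<^sup>2 = gap 0"
    by (cases "gap 0 = 0") (simp_all add: power2_eq_square)
  then have coeff: "(2 * norm (X 0) * inverse (gap 0) + 1 / 2) * (gap 0)\<^sup>2
      = 2 * norm (X 0) * gap 0 + (gap 0)\<^sup>2 / 2"
    by (simp add: distrib_right mult.assoc)
  ultimately show ?thesis
    unfolding coeff using objective_sum_telescopes[of K] by (simp add: algebra_simps)
qed

lemma truncation_le_gap_drop:
  fixes k :: nat
  defines "X' \<equiv> X_step (X k) (S k)"
  defines "P \<equiv> closest_point (psd_ball RX) X'"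
  shows "2 * (RX - norm Xs) * norm (X' - P) \<le> (gap k)\<^sup>2 - (gap (Suc k))\<^sup>2 + 4 * (RX + RS) * \<epsilon>"
proof -
  let ?S' = "S_step (X k) (S k)"
  have gain: "2 * (RX - norm Xs) * norm (X' - P) \<le> (norm (X' - Xs))\<^sup>2 - (norm (P - Xs))\<^sup>2"
    unfolding P_def psd_ball_eq
    by (rule closest_point_cone_cball_gain[OF closed_psd convex_psd cone_psd _ radii(1)])
      (simp add: X'_def psd_X_step sym_X)
  have contract: "(norm (X' - Xs))\<^sup>2 + (norm (?S' - Ss))\<^sup>2 \<le> (gap k)\<^sup>2"
    using power_mono[OF exact_step_contracts[of "X k" "S k"], of 2]
    by (simp add: gap_squared norm_Pair X'_def)
  have "norm (X (Suc k) - Xs) \<le> norm (P - Xs) + \<epsilon>"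
    using norm_triangle_ineq[of "X (Suc k) - P" "P - Xs"] X_err[of k] by (simp add: P_def X'_def)
  moreover have "norm (X (Suc k) - Xs) \<le> 2 * RX"
    using norm_triangle_ineq4[of "X (Suc k)" Xs] X_mem[of k] radii by (simp add: psd_ball_def)
  ultimately have x: "(norm (X (Suc k) - Xs))\<^sup>2 - 2 * (2 * RX) * \<epsilon> \<le> (norm (P - Xs))\<^sup>2"
    using eps_nonneg by (intro square_ge_minus_error) auto
  have "norm (S (Suc k) - Ss) \<le> 2 * RS"
    using norm_triangle_ineq4[of "S (Suc k)" Ss] S_mem[of k] radii by (simp add: psd_ball_def)
  then have s: "(norm (S (Suc k) - Ss))\<^sup>2 - 2 * (2 * RS) * \<epsilon> \<le> (norm (?S' - Ss))\<^sup>2"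
    using S_Suc_le[OF solution_in_balls(2), of k] eps_nonneg by (intro square_ge_minus_error) auto
  show ?thesis using gain contract x s gap_squared[of "Suc k"] by (simp add: algebra_simps)
qed

lemma truncation_sum_telescopes:
  "2 * (RX - norm Xs) * (\<Sum>k<K. norm (X_step (X (Suc k)) (S (Suc k))
        - closest_point (psd_ball RX) (X_step (X (Suc k)) (S (Suc k)))))
    \<le> (gap 1)\<^sup>2 - (gap (Suc K))\<^sup>2 + real K * (4 * (RX + RS) * \<epsilon>)"
proof (induction K)
  case (Suc k)
  then show ?case using truncation_le_gap_drop[of "Suc k"] by (simp add: algebra_simps)
qed simp

text \<open>
  The first step is bounded directly by \<open>gap 0\<close>: the starting point may be arbitrarily far away, and
  the telescoping bound would give its square. From index 1 on, the iterates lie in the balls, so the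
  factor \<open>gap 1\<close> of \<open>(gap 1)\<^sup>2\<close> can be traded for a constant.
\<close>

lemma truncation_sum_le:
  assumes margin: "norm Xs < RX" and K: "1 \<le> K"
  defines "c \<equiv> (RX + RS) / (RX - norm Xs)"
  shows "(\<Sum>k<K. norm (X_step (X k) (S k) - closest_point (psd_ball RX) (X_step (X k) (S k))))
    \<le> (1 + c) * gap 0 + real K * (4 * c * \<epsilon>)"
proof -
  let ?tr = "\<lambda>k. norm (X_step (X k) (S k) - closest_point (psd_ball RX) (X_step (X k) (S k)))"
  let ?m = "RX - norm Xs"
  obtain n where n: "K = Suc n" using K by (cases K) auto
  have c: "0 \<le> c" using radii_nonneg margin by (simp add: c_def)
  have "?tr 0 \<le> norm (X_step (X 0) (S 0) - Xs)"
    using closest_point_le[OF closed_psd_ball solution_in_balls(1)] by (simp add: dist_norm)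
  also have "\<dots> \<le> norm (X_step (X 0) (S 0) - Xs, S_step (X 0) (S 0) - Ss)"
    by (simp add: norm_Pair real_le_rsqrt)
  also have "\<dots> \<le> gap 0" unfolding gap_def by (rule exact_step_contracts)
  finally have first: "?tr 0 \<le> gap 0" .
  have "gap 1 \<le> norm (X 1 - Xs) + norm (S 1 - Ss)" unfolding gap_def by (rule norm_Pair_le)
  also have "\<dots> \<le> 2 * (RX + RS)"
    using norm_triangle_ineq4[of "X 1" Xs] norm_triangle_ineq4[of "S 1" Ss] X_mem[of 0] S_mem[of 0]
      radii by (simp add: psd_ball_def)
  finally have "(gap 1)\<^sup>2 \<le> 2 * (RX + RS) * (gap 0 + 2 * \<epsilon>)"
    unfolding power2_eq_square using gap_Suc_le[of 0] gap_nonneg radii_nonneg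
    by (intro mult_mono) auto
  moreover have "0 \<le> (gap (Suc n))\<^sup>2" by simp
  ultimately have "2 * ?m * (\<Sum>k<n. ?tr (Suc k))
      \<le> 2 * (RX + RS) * (gap 0 + 2 * \<epsilon>) + real n * (4 * (RX + RS) * \<epsilon>)"
    using truncation_sum_telescopes[of n] by linarith
  also have "RX + RS = ?m * c" using margin by (simp add: c_def)
  also have "2 * (?m * c) * (gap 0 + 2 * \<epsilon>) + real n * (4 * (?m * c) * \<epsilon>)
      = 2 * ?m * (c * (gap 0 + 2 * \<epsilon>) + real n * (2 * c * \<epsilon>))"
    by (simp add: algebra_simps)
  finally have "(\<Sum>k<n. ?tr (Suc k)) \<le> c * (gap 0 + 2 * \<epsilon>) + real n * (2 * c * \<epsilon>)"
    using margin by simp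
  moreover have "0 \<le> real n * (2 * c * \<epsilon>)" "0 \<le> c * \<epsilon>" using c eps_nonneg by simp_all
  ultimately show ?thesis
    using first unfolding n sum.lessThan_Suc_shift by (simp add: algebra_simps)
qed

lemma residual_sum_le:
  assumes margin: "norm Xs < RX" and K: "1 \<le> K"
  defines "c \<equiv> (RX + RS) / (RX - norm Xs)"
  shows "norm (\<Sum>k<K. adjA A (y_step (X k) (S k)) + S_step (X k) (S k) - C)
    \<le> (3 + c) * gap 0 + real K * ((3 + 4 * c) * \<epsilon>)"
proof -
  \<comment> \<open>\<open>X' - X k\<close> splits into the truncated part, the perturbation and a telescoping difference.\<close>
  let ?P = "\<lambda>k. closest_point (psd_ball RX) (X_step (X k) (S k))"
  have "(\<Sum>k<K. adjA A (y_step (X k) (S k)) + S_step (X k) (S k) - C)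
      = (\<Sum>k<K. X_step (X k) (S k) - ?P k) - (\<Sum>k<K. X (Suc k) - ?P k) + (\<Sum>k<K. X (Suc k) - X k)"
    by (simp add: residual_eq sum.distrib[symmetric] sum_subtractf[symmetric])
  also have "(\<Sum>k<K. X (Suc k) - X k) = X K - X 0" by (rule sum_lessThan_telescope)
  finally have "norm (\<Sum>k<K. adjA A (y_step (X k) (S k)) + S_step (X k) (S k) - C)
      \<le> norm (\<Sum>k<K. X_step (X k) (S k) - ?P k) + norm (\<Sum>k<K. X (Suc k) - ?P k) + norm (X K - X 0)"
    by (smt (verit) norm_triangle_ineq norm_triangle_ineq4)
  moreover have "norm (\<Sum>k<K. X_step (X k) (S k) - ?P k) \<le> (1 + c) * gap 0 + real K * (4 * c * \<epsilon>)"
    unfolding c_def by (rule order_trans[OF norm_sum truncation_sum_le[OF margin K]])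
  moreover have "norm (\<Sum>k<K. X (Suc k) - ?P k) \<le> real K * \<epsilon>"
    using sum_norm_bound[of "{..<K}" "\<lambda>k. X (Suc k) - ?P k" \<epsilon>] X_err by simp
  ultimately show ?thesis using norm_X_diff_le[of K] by (simp add: algebra_simps)
qed

end

section \<open>Ergodic rates\<close>

lemma ergodic_avg_eq: "ergodic_avg K u = (1 / real K) *\<^sub>R (\<Sum>k<K. u (Suc k))"
  unfolding ergodic_avg_def by (simp add: sum.atLeast1_atMost_eq)

lemma dual_obj_ergodic_avg:
  assumes "1 \<le> K"
  shows "real K * (dual_obj b (ergodic_avg K u) - dual_obj b y)
    = (\<Sum>k<K. dual_obj b (u (Suc k)) - dual_obj b y)"
  using assms by (simp add: ergodic_avg_eq dual_obj_def inner_sum_right sum_subtractf sum_negf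
      right_diff_distrib)

lemma residual_ergodic_avg:
  assumes "1 \<le> K"
  shows "real K *\<^sub>R (adjA A (ergodic_avg K y) + ergodic_avg K S - C)
    = (\<Sum>k<K. adjA A (y (Suc k)) + S (Suc k) - C)"
  using assms by (simp add: ergodic_avg_eq adjA_scaleR adjA_sum sum_subtractf sum.distrib
      scaleR_right_distrib scaleR_right_diff_distrib sum_constant_scaleR del: sum_constant)

text \<open>
  The summand \<open>1\<close> makes the constant positive even when \<open>p\<close> and \<open>q * \<mu>\<close> vanish.
\<close>

lemma rate_from_sum_bound:
  fixes v :: real
  assumes K: "1 \<le> K" and sum: "real K * v \<le> p * D + real K * (q * \<epsilon>)" and \<epsilon>: "\<epsilon> \<le> \<mu> * \<delta>"
    and nonneg: "0 \<le> p" "0 \<le> q" "0 \<le> \<mu>" "0 \<le> D" "0 \<le> \<delta>"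
  shows "v \<le> (p + q * \<mu> + 1) * (D / real K + \<delta>)"
proof -
  have "v \<le> p * (D / real K) + q * \<epsilon>" using sum K by (simp add: field_simps)
  also have "\<dots> \<le> p * (D / real K) + q * (\<mu> * \<delta>)"
    using \<epsilon> nonneg by (intro add_left_mono mult_left_mono)
  also have "\<dots> \<le> p * (D / real K + \<delta>) + (q * \<mu>) * (D / real K + \<delta>) + (D / real K + \<delta>)"
    using nonneg by (simp add: distrib_left mult.assoc)
  finally show ?thesis by (simp add: distrib_right)
qed

theorem theorem4p1:
  fixes A :: "real^'n^'n^'m" and b :: "real^'m" and C :: "real^'n^'n"
    and RX Ry RS \<theta>1 \<theta>2 :: real
    and Xs :: "real^'n^'n" and ys :: "real^'m" and Ss :: "real^'n^'n"
  assumes "sdp_data A C"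
    and "sdp_optimal A b C Xs ys Ss"
    and "norm Xs \<le> RX" and "norm1 ys \<le> Ry" and "norm Ss \<le> RS"
    and "0 < \<theta>1" and "0 < \<theta>2"
  shows
    "(\<forall>X0 y0 S0. sym_mat X0 \<and> sym_mat S0 \<longrightarrow>
       (\<exists>c>0. \<forall>g1 g2 tol run K \<delta>.
          is_qadmm_run 1 A b C RX Ry RS g1 g2 tol X0 y0 S0 run \<and> K \<ge> 1
          \<and> \<theta>1 * total_tol tol \<le> \<delta> \<and> \<delta> \<le> \<theta>2 * total_tol tol \<longrightarrow>
          dual_obj b (ergodic_avg K (it_yhat run)) - dual_obj b ys
            \<le> c * (((norm (X0 - Xs))\<^sup>2 + (norm (S0 - Ss))\<^sup>2) / real K + \<delta>)))
   \<and> (norm Xs < RX \<longrightarrow>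
       (\<exists>c>0. \<forall>X0 y0 S0 g1 g2 tol run K \<delta>.
          sym_mat X0 \<and> sym_mat S0
          \<and> is_qadmm_run 1 A b C RX Ry RS g1 g2 tol X0 y0 S0 run \<and> K \<ge> 1
          \<and> \<theta>1 * total_tol tol \<le> \<delta> \<and> \<delta> \<le> \<theta>2 * total_tol tol \<longrightarrow>
          norm (adjA A (ergodic_avg K (it_yhat run)) + ergodic_avg K (it_Stil run) - C)
            \<le> c * ((norm (X0 - Xs) + norm (S0 - Ss)) / real K + \<delta>)))"
proof -
  interpret sdp_solution A b C Xs ys Ss
    using assms(1,2) by unfold_locales
  define \<kappa> where "\<kappa> = (real CARD('n))\<^sup>2 + 2"
  define \<mu> where "\<mu> = \<kappa> / \<theta>1"
  have \<mu>: "0 \<le> \<mu>" using \<open>0 < \<theta>1\<close> by (simp add: \<mu>_def \<kappa>_def)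
  have radii: "0 \<le> RX" "0 \<le> RS"
    using assms(3,5) norm_ge_zero order_trans by blast+

  have run: "inexact_run A b C Xs ys Ss RX RS (\<kappa> * total_tol tol) (it_X run) (it_S run)"
    and yhat: "it_yhat run (Suc k) = y_step (it_X run k) (it_S run k)"
    and Stil: "norm (it_Stil run (Suc k) - S_step (it_X run k) (it_S run k)) \<le> \<kappa> * total_tol tol"
    if "is_qadmm_run 1 A b C RX Ry RS g1 g2 tol X0 y0 S0 run" "sym_mat X0"
    for g1 g2 tol X0 y0 S0 k and run :: "('n, 'm) qadmm_run"
  proof -
    have step: "qadmm_step 1 A b C RX Ry RS g1 g2 tol run j" for j
      using that by (simp add: is_qadmm_run_def)
    note near = qadmm_step_near_exact[OF step assms(3,5), folded \<kappa>_def]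
    show "inexact_run A b C Xs ys Ss RX RS (\<kappa> * total_tol tol) (it_X run) (it_S run)"
      using near(3-6) that assms(3,5) by unfold_locales (simp_all add: is_qadmm_run_def)
    show "it_yhat run (Suc k) = y_step (it_X run k) (it_S run k)"
      "norm (it_Stil run (Suc k) - S_step (it_X run k) (it_S run k)) \<le> \<kappa> * total_tol tol"
      by (fact near)+
  qed
  have tol_le: "\<kappa> * total_tol tol \<le> \<mu> * \<delta>" if "\<theta>1 * total_tol tol \<le> \<delta>" for tol \<delta>
    using that \<open>0 < \<theta>1\<close> mult_left_mono[of "\<theta>1 * total_tol tol" \<delta> \<kappa>]
    by (simp add: \<mu>_def \<kappa>_def field_simps)
  have \<delta>_nonneg: "0 \<le> \<delta>" if "0 \<le> \<kappa> * total_tol tol" "\<theta>1 * total_tol tol \<le> \<delta>" for tol \<delta>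
  proof -
    have "0 < \<kappa>" by (simp add: \<kappa>_def add_nonneg_pos)
    then have "0 \<le> total_tol tol" using that(1) by (simp add: zero_le_mult_iff)
    then have "0 \<le> \<theta>1 * total_tol tol" using \<open>0 < \<theta>1\<close> by simp
    then show ?thesis using that(2) by linarith
  qed

  show ?thesis
  proof (intro conjI allI impI)
    fix X0 S0 :: "real^'n^'n" and y0 :: "real^'m"
    assume sym: "sym_mat X0 \<and> sym_mat S0"
    define d where "d = norm (X0 - Xs, S0 - Ss)"
    define p where "p = 2 * norm X0 * inverse d + 1 / 2"
    define q where "q = 2 * norm X0 + RX + 2 * RS"
    have pq: "0 \<le> p" "0 \<le> q" using radii by (simp_all add: p_def q_def d_def)
    show "\<exists>c>0. \<forall>g1 g2 tol run K \<delta>.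
          is_qadmm_run 1 A b C RX Ry RS g1 g2 tol X0 y0 S0 run \<and> K \<ge> 1
          \<and> \<theta>1 * total_tol tol \<le> \<delta> \<and> \<delta> \<le> \<theta>2 * total_tol tol \<longrightarrow>
          dual_obj b (ergodic_avg K (it_yhat run)) - dual_obj b ys
            \<le> c * (((norm (X0 - Xs))\<^sup>2 + (norm (S0 - Ss))\<^sup>2) / real K + \<delta>)"
    proof (intro exI[of _ "p + q * \<mu> + 1"] conjI allI impI)
      show "0 < p + q * \<mu> + 1" using pq \<mu> by (simp add: add_nonneg_pos)
      fix g1 g2 tol \<delta> and K :: nat and run :: "('n, 'm) qadmm_run"
      assume H: "is_qadmm_run 1 A b C RX Ry RS g1 g2 tol X0 y0 S0 run \<and> K \<ge> 1
          \<and> \<theta>1 * total_tol tol \<le> \<delta> \<and> \<delta> \<le> \<theta>2 * total_tol tol"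
      then have init: "it_X run 0 = X0" "it_S run 0 = S0" by (simp_all add: is_qadmm_run_def)
      interpret r: inexact_run A b C Xs ys Ss RX RS "\<kappa> * total_tol tol" "it_X run" "it_S run"
        using run H sym by blast
      have D: "(norm (X0 - Xs))\<^sup>2 + (norm (S0 - Ss))\<^sup>2 = (r.gap 0)\<^sup>2" and d: "d = r.gap 0"
        by (simp_all add: r.gap_squared r.gap_def d_def norm_Pair init)
      have y: "it_yhat run (Suc k) = y_step (it_X run k) (it_S run k)" for k
        using yhat H sym by blast
      show "dual_obj b (ergodic_avg K (it_yhat run)) - dual_obj b ys
            \<le> (p + q * \<mu> + 1) * (((norm (X0 - Xs))\<^sup>2 + (norm (S0 - Ss))\<^sup>2) / real K + \<delta>)"
      proof (rule rate_from_sum_bound)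
        show "real K * (dual_obj b (ergodic_avg K (it_yhat run)) - dual_obj b ys)
            \<le> p * ((norm (X0 - Xs))\<^sup>2 + (norm (S0 - Ss))\<^sup>2) + real K * (q * (\<kappa> * total_tol tol))"
          using r.objective_sum_le[of K] H unfolding D p_def q_def d
          by (simp add: dual_obj_ergodic_avg y init)
        show "0 \<le> \<delta>" using \<delta>_nonneg[OF r.eps_nonneg] H by blast
        show "\<kappa> * total_tol tol \<le> \<mu> * \<delta>" using tol_le H by blast
      qed (use H pq \<mu> in auto)
    qed
  next
    assume margin: "norm Xs < RX"
    define c where "c = (RX + RS) / (RX - norm Xs)"
    have c: "0 \<le> c" using radii margin by (simp add: c_def)
    show "\<exists>c>0. \<forall>X0 y0 S0 g1 g2 tol run K \<delta>.
          sym_mat X0 \<and> sym_mat S0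
          \<and> is_qadmm_run 1 A b C RX Ry RS g1 g2 tol X0 y0 S0 run \<and> K \<ge> 1
          \<and> \<theta>1 * total_tol tol \<le> \<delta> \<and> \<delta> \<le> \<theta>2 * total_tol tol \<longrightarrow>
          norm (adjA A (ergodic_avg K (it_yhat run)) + ergodic_avg K (it_Stil run) - C)
            \<le> c * ((norm (X0 - Xs) + norm (S0 - Ss)) / real K + \<delta>)"
    proof (intro exI[of _ "(3 + c) + (4 + 4 * c) * \<mu> + 1"] conjI allI impI)
      show "0 < (3 + c) + (4 + 4 * c) * \<mu> + 1" using c \<mu> by (intro add_nonneg_pos add_nonneg_nonneg) auto
      fix X0 S0 :: "real^'n^'n" and y0 g1 g2 tol \<delta> and K :: nat and run :: "('n, 'm) qadmm_run"
      assume H: "sym_mat X0 \<and> sym_mat S0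
          \<and> is_qadmm_run 1 A b C RX Ry RS g1 g2 tol X0 y0 S0 run \<and> K \<ge> 1
          \<and> \<theta>1 * total_tol tol \<le> \<delta> \<and> \<delta> \<le> \<theta>2 * total_tol tol"
      then have init: "it_X run 0 = X0" "it_S run 0 = S0" by (simp_all add: is_qadmm_run_def)
      let ?\<epsilon> = "\<kappa> * total_tol tol"
      interpret r: inexact_run A b C Xs ys Ss RX RS ?\<epsilon> "it_X run" "it_S run"
        using run H by blast
      let ?y = "\<lambda>k. y_step (it_X run k) (it_S run k)"
      let ?S = "\<lambda>k. S_step (it_X run k) (it_S run k)"
      have y: "it_yhat run (Suc k) = ?y k" and S: "norm (it_Stil run (Suc k) - ?S k) \<le> ?\<epsilon>" for k
        using yhat Stil H by blast+
      have gap0: "r.gap 0 \<le> norm (X0 - Xs) + norm (S0 - Ss)"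
        unfolding r.gap_def init by (rule norm_Pair_le)
      let ?res = "adjA A (ergodic_avg K (it_yhat run)) + ergodic_avg K (it_Stil run) - C"
      show "norm ?res \<le> ((3 + c) + (4 + 4 * c) * \<mu> + 1)
          * ((norm (X0 - Xs) + norm (S0 - Ss)) / real K + \<delta>)"
      proof (rule rate_from_sum_bound)
        have "real K * norm ?res = norm (real K *\<^sub>R ?res)" by simp
        also have "real K *\<^sub>R ?res = (\<Sum>k<K. adjA A (?y k) + ?S k - C)
            + (\<Sum>k<K. it_Stil run (Suc k) - ?S k)"
          using H by (simp add: residual_ergodic_avg y sum.distrib[symmetric]) (simp add: add_diff_eq)
        also have "norm \<dots> \<le> ((3 + c) * r.gap 0 + real K * ((3 + 4 * c) * ?\<epsilon>)) + real K * ?\<epsilon>"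
        proof (rule norm_triangle_mono)
          show "norm (\<Sum>k<K. adjA A (?y k) + ?S k - C)
              \<le> (3 + c) * r.gap 0 + real K * ((3 + 4 * c) * ?\<epsilon>)"
            unfolding c_def using H by (intro r.residual_sum_le margin) blast
          show "norm (\<Sum>k<K. it_Stil run (Suc k) - ?S k) \<le> real K * ?\<epsilon>"
            using sum_norm_bound[of "{..<K}" "\<lambda>k. it_Stil run (Suc k) - ?S k" ?\<epsilon>] S by simp
        qed
        also have "\<dots> = (3 + c) * r.gap 0 + real K * ((4 + 4 * c) * ?\<epsilon>)"
          by (simp add: algebra_simps)
        also have "\<dots> \<le> (3 + c) * (norm (X0 - Xs) + norm (S0 - Ss)) + real K * ((4 + 4 * c) * ?\<epsilon>)"
          using gap0 c by (intro add_right_mono mult_left_mono) auto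
        finally show "real K * norm ?res \<le> \<dots>" .
        show "0 \<le> \<delta>" using \<delta>_nonneg[OF r.eps_nonneg] H by blast
        show "\<kappa> * total_tol tol \<le> \<mu> * \<delta>" using tol_le H by blast
      qed (use H c \<mu> in auto)
    qed
  qed
qed

end
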